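(* Let $0<\alpha<1$. Then the Ces\`aro operator $\mathcal{C}$ is bounded on $H^\infty_{\alpha,\log}$, its norm satisfies $$\|\mathcal{C}\|_{H^\infty_{\alpha,\log}\to H^\infty_{\alpha,\log}}=\sup_{0\le r<1}\int_0^\infty\frac{(1+r)^\alpha e^{-t}\big(1-(1-e^{-t})r\big)^{2\alpha-1}\log\dfrac{2e^{1/\alpha}}{1-r^2}}{\big(1-(1-2e^{-t})r\big)^\alpha\log\dfrac{2e^{1/\alpha}}{1-\left(\frac{e^{-t}r}{1-(1-e^{-t})r}\right)^2}}\,dt,$$ and $$\|\mathcal{C}\|_{H^\infty_{\alpha,\log}\to H^\infty_{\alpha,\log}}\ge\frac1\alpha.$$
   Context: $\mathbb{D}$ is the open unit disc and $H(\mathbb{D})$ the space of analytic functions on $\mathbb{D}$. For $f(z)=\sum_{k\ge0}a_kz^k\in H(\mathbb{D})$ the Ces\`aro operator is $\mathcal{C}(f)(z)=\sum_{n\ge0}\Big(\frac{1}{n+1}\sum_{k=0}^n a_k\Big)z^n=\int_0^1\frac{f(tz)}{1-tz}\,dt$. For $0<\alpha<1$, the logarithmically weighted Korenblum space $H^\infty_{\alpha,\log}$ consists of $f\in H(\mathbb{D})$ with $\|f\|_{H^\infty_{\alpha,\log}}=\sup_{z\in\mathbb{D}}(1-|z|^2)^\alpha\log\frac{2e^{1/\alpha}}{1-|z|^2}\,|f(z)|<\infty$. Operator norms are $\|\mathcal{C}\|_{X\to Y}=\sup\{\|\mathcal{C}f\|_Y:\|f\|_X\le 1\}$. *)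

theory Defs
  imports "HOL-Analysis.Analysis"
begin

definition cesaro :: "(complex \<Rightarrow> complex) \<Rightarrow> complex \<Rightarrow> complex" where
  "cesaro f z = integral {0..1::real} (\<lambda>t. f (of_real t * z) / (1 - of_real t * z))"

definition klog_weight :: "real \<Rightarrow> complex \<Rightarrow> real" where
  "klog_weight \<alpha> z = (1 - (cmod z)\<^sup>2) powr \<alpha> * ln (2 * exp (1/\<alpha>) / (1 - (cmod z)\<^sup>2))"

definition klog_norm :: "real \<Rightarrow> (complex \<Rightarrow> complex) \<Rightarrow> ennreal" where
  "klog_norm \<alpha> f = (SUP z\<in>ball 0 1. ennreal (klog_weight \<alpha> z * cmod (f z)))"

definition klog_space :: "real \<Rightarrow> (complex \<Rightarrow> complex) set" where
  "klog_space \<alpha> = {f. f holomorphic_on ball 0 1 \<and> klog_norm \<alpha> f < \<infinity>}"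

definition cesaro_klog_opnorm :: "real \<Rightarrow> ennreal" where
  "cesaro_klog_opnorm \<alpha> =
     (SUP f\<in>{f. f holomorphic_on ball 0 1 \<and> klog_norm \<alpha> f \<le> 1}. klog_norm \<alpha> (cesaro f))"

definition cesaro_kernel :: "real \<Rightarrow> real \<Rightarrow> real \<Rightarrow> real" where
  "cesaro_kernel \<alpha> r t =
     ((1 + r) powr \<alpha> * exp (-t) * (1 - (1 - exp (-t)) * r) powr (2*\<alpha> - 1)
        * ln (2 * exp (1/\<alpha>) / (1 - r\<^sup>2)))
     / ((1 - (1 - 2 * exp (-t)) * r) powr \<alpha>
        * ln (2 * exp (1/\<alpha>) / (1 - (exp (-t) * r / (1 - (1 - exp (-t)) * r))\<^sup>2)))"

end

theory Submission
  imports Defs "HOL-Complex_Analysis.Complex_Analysis"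
begin

text \<open>
  Write \<open>w\<close> for the weight and \<open>r = |z|\<close>. Bounding the integrand of \<open>C f (z)\<close> pointwise gives
  \<open>w(r) |C f (z)| \<le> \<parallel>f\<parallel> I(r)\<close> with \<open>I(r) = w(r) \<integral>\<^sub>0\<^sup>1 ds / (w(sr) (1 - sr))\<close>,
  and \<open>I(r)\<close> is the integral in the statement after a change of variables. Equality in the supremum
  is attained by \<open>f(z) = (1 - z\<^sup>2)\<^bsup>-\<alpha>\<^esup> / log (2 e\<^bsup>1/\<alpha>\<^esup> / (1 - z\<^sup>2))\<close>, which
  equals \<open>1 / w\<close> on \<open>[0, 1)\<close> and has norm at most one because \<open>u\<^bsup>\<alpha>\<^esup> log (2 e\<^bsup>1/\<alpha>\<^esup> / u)\<close>
  increases on \<open>(0, 2]\<close>. Comparing \<open>w(r) / w(sr)\<close> with powers of \<open>(1 - r) / (1 - sr)\<close>,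
  with exponent \<open>\<alpha>/2\<close> from above and \<open>\<alpha>\<close> from below, shows that
  \<open>I\<close> is bounded and that \<open>I(r) \<ge> (1 - (1 - r)\<^bsup>\<alpha>\<^esup>) / \<alpha>\<close>.
\<close>

section \<open>The weight as a function of \<open>u = 1 - |z|^2\<close>\<close>

definition log_power :: "real \<Rightarrow> real \<Rightarrow> real" where
  "log_power \<alpha> u = u powr \<alpha> * ln (2 * exp (1/\<alpha>) / u)"

lemma klog_weight_eq_log_power: "klog_weight \<alpha> z = log_power \<alpha> (1 - (cmod z)\<^sup>2)"
  by (simp add: klog_weight_def log_power_def)

lemma ln_two_exp_div:
  fixes u \<alpha> :: real
  assumes "0 < u"
  shows "ln (2 * exp (1/\<alpha>) / u) = ln 2 + 1/\<alpha> - ln u"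
  using assms by (simp add: ln_div ln_mult)

text \<open>Since \<open>ln u \<le> ln 2\<close>, a margin of \<open>1/\<alpha>\<close> remains. It
  absorbs the factor \<open>1/\<alpha>\<close> that arises when logarithms are replaced by powers in
  the two comparison lemmas below.\<close>

lemma inverse_le_ln_two_exp_div:
  fixes u \<alpha> :: real
  assumes "0 < u" "u \<le> 2"
  shows "1/\<alpha> \<le> ln (2 * exp (1/\<alpha>) / u)"
  using assms by (simp add: ln_two_exp_div)

lemma log_power_pos:
  assumes "0 < \<alpha>" "0 < u" "u \<le> 2"
  shows "0 < log_power \<alpha> u"
proof -
  have "0 < 1/\<alpha>" using assms by simp
  then have "0 < ln (2 * exp (1/\<alpha>) / u)"
    using inverse_le_ln_two_exp_div[OF assms(2,3), of \<alpha>] by linarith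
  then show ?thesis
    using assms by (simp add: log_power_def)
qed

lemma ln_le_powr_minus_one_div:
  fixes y b :: real
  assumes "0 < b" "0 < y"
  shows "ln y \<le> (y powr b - 1) / b"
proof -
  have "b * ln y = ln (y powr b)" using assms by (simp add: ln_powr)
  also have "\<dots> \<le> y powr b - 1" using assms by (intro ln_le_minus_one) simp
  finally show ?thesis using assms by (simp add: field_simps)
qed

text \<open>The constant \<open>2 e\<^bsup>1/\<alpha>\<^esup>\<close> makes this hold up to \<open>u = 2\<close>, the supremum of
  \<open>|1 - z\<^sup>2|\<close> over the disc.\<close>

lemma log_power_mono:
  assumes "0 < \<alpha>" "0 < u" "u \<le> v" "v \<le> 2"
  shows "log_power \<alpha> u \<le> log_power \<alpha> v"
proof -
  define y where "y = v / u"
  define k where "k = ln (2 * exp (1/\<alpha>) / v)"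
  have y: "1 \<le> y" "v = u * y" using assms by (auto simp: y_def)
  have k: "1/\<alpha> \<le> k" unfolding k_def using assms by (intro inverse_le_ln_two_exp_div) auto
  have y1: "1 \<le> y powr \<alpha>" using y assms by (simp add: ge_one_powr_ge_zero)
  have "ln (2 * exp (1/\<alpha>) / u) = k + ln y"
    unfolding k_def y_def using assms by (simp add: ln_two_exp_div ln_div)
  also have "\<dots> \<le> k + (y powr \<alpha> - 1) * (1/\<alpha>)"
    using ln_le_powr_minus_one_div[of \<alpha> y] assms y by simp
  \<comment> \<open>Because \<open>1/\<alpha> \<le> k\<close>, the logarithm grows at most by the
    factor \<open>y powr \<alpha>\<close>, exactly the factor that separates
    \<open>u powr \<alpha>\<close> from \<open>v powr \<alpha>\<close>.\<close>
  also have "\<dots> \<le> k + (y powr \<alpha> - 1) * k"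
    using k y1 by (intro add_left_mono mult_left_mono) auto
  finally have "ln (2 * exp (1/\<alpha>) / u) \<le> y powr \<alpha> * k" by (simp add: algebra_simps)
  then have "log_power \<alpha> u \<le> u powr \<alpha> * (y powr \<alpha> * k)"
    unfolding log_power_def by (intro mult_left_mono) auto
  also have "\<dots> = log_power \<alpha> v"
    unfolding log_power_def k_def[symmetric] using assms y by (simp add: powr_mult)
  finally show ?thesis .
qed

text \<open>Half of the exponent pays for the logarithm, and the other half survives as decay in
  \<open>u / v\<close>. Monotonicity alone would only give \<open>w(r) / w(sr) \<le> 1\<close>, and
  the integral of \<open>1 / (1 - s * r)\<close> is unbounded as r tends to 1.\<close>

lemma log_power_le_powr_half:
  assumes "0 < \<alpha>" "0 < u" "u \<le> v" "v \<le> 2"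
  shows "log_power \<alpha> u \<le> 3 * (u / v) powr (\<alpha>/2) * log_power \<alpha> v"
proof -
  define y where "y = v / u"
  define k where "k = ln (2 * exp (1/\<alpha>) / v)"
  have y: "1 \<le> y" "v = u * y" using assms by (auto simp: y_def)
  have k: "1/\<alpha> \<le> k" unfolding k_def using assms by (intro inverse_le_ln_two_exp_div) auto
  have y1: "1 \<le> y powr (\<alpha>/2)" using y assms by (simp add: ge_one_powr_ge_zero)
  have k0: "0 \<le> k" using k assms by (smt (verit) zero_le_divide_1_iff)
  have "ln (2 * exp (1/\<alpha>) / u) = k + ln y"
    unfolding k_def y_def using assms by (simp add: ln_two_exp_div ln_div)
  also have "\<dots> \<le> k + 2 * (y powr (\<alpha>/2) - 1) * (1/\<alpha>)"
    using ln_le_powr_minus_one_div[of "\<alpha>/2" y] assms y by (simp add: field_simps)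
  also have "\<dots> \<le> k + 2 * (y powr (\<alpha>/2) - 1) * k"
    using k y1 by (intro add_left_mono mult_left_mono) auto
  \<comment> \<open>With \<open>Y = y powr (\<alpha>/2)\<close> the left side is
    \<open>(2 * Y - 1) * k\<close>; the constant 3 is a generous choice.\<close>
  also have "\<dots> \<le> 3 * y powr (\<alpha>/2) * k"
    using mult_right_mono[OF y1 k0] k0 by (simp add: algebra_simps)
  finally have "log_power \<alpha> u \<le> u powr \<alpha> * (3 * y powr (\<alpha>/2) * k)"
    unfolding log_power_def by (intro mult_left_mono) auto
  also have "\<dots> = 3 * (u powr \<alpha> * y powr (\<alpha>/2)) * k" by simp
  also have "u powr \<alpha> * y powr (\<alpha>/2) = (u / v) powr (\<alpha>/2) * v powr \<alpha>"
    using assms by (simp add: y_def powr_def ln_div field_simps flip: exp_add)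
  finally show ?thesis
    unfolding log_power_def k_def[symmetric] by simp
qed

lemma one_minus_square_bounds:
  fixes x :: real
  assumes "0 \<le> x" "x < 1"
  shows "0 < 1 - x\<^sup>2" "1 - x\<^sup>2 \<le> 1"
  using assms by (auto simp: power_less_one_iff abs_square_less_1)

lemma log_power_one_minus_square_pos:
  assumes "0 < \<alpha>" "0 \<le> x" "x < 1"
  shows "0 < log_power \<alpha> (1 - x\<^sup>2)"
  using log_power_pos[OF assms(1), of "1 - x\<^sup>2"] one_minus_square_bounds[OF assms(2,3)] by linarith

section \<open>The radial integral I(r)\<close>

text \<open>The majorant of the Cesaro integrand on \<open>|z| = r\<close> for f of norm at most
  one: \<open>|f|\<close> is replaced by \<open>1 / w\<close> and \<open>|1 - s z|\<close> by its
  lower bound \<open>1 - s r\<close>.\<close>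

definition radial_kernel :: "real \<Rightarrow> real \<Rightarrow> real \<Rightarrow> real" where
  "radial_kernel \<alpha> r s = 1 / (log_power \<alpha> (1 - (s * r)\<^sup>2) * (1 - s * r))"

lemma mult_less_one:
  fixes s r :: real
  assumes "0 \<le> s" "s \<le> 1" "0 \<le> r" "r < 1"
  shows "0 \<le> s * r" "s * r \<le> r" "s * r < 1"
  using assms mult_left_le_one_le[of r s] by auto

lemma continuous_on_radial_kernel:
  assumes "0 < \<alpha>" and "\<And>s. s \<in> S \<Longrightarrow> 0 \<le> s * r \<and> s * r < 1"
  shows "continuous_on S (radial_kernel \<alpha> r)"
proof -
  have *: "1 - (s * r)\<^sup>2 > 0" "1 - (s * r)\<^sup>2 \<noteq> 0" "(s * r)\<^sup>2 \<noteq> 1" "1 - s * r \<noteq> 0"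
    "log_power \<alpha> (1 - (s * r)\<^sup>2) \<noteq> 0" if "s \<in> S" for s
    using one_minus_square_bounds[of "s*r"] assms(2)[OF that]
      log_power_one_minus_square_pos[of \<alpha> "s*r"] assms(1) by auto
  have "continuous_on S (\<lambda>s. log_power \<alpha> (1 - (s * r)\<^sup>2))"
    unfolding log_power_def using *
    by (intro continuous_intros) (auto simp: zero_less_mult_iff)
  then show ?thesis
    unfolding radial_kernel_def using *(4,5) by (intro continuous_intros) auto
qed

lemma radial_kernel_integrable:
  assumes "0 < \<alpha>" "0 \<le> r" "r < 1"
  shows "radial_kernel \<alpha> r integrable_on {0..1}"
  using assms mult_less_one
  by (intro integrable_continuous_real continuous_on_radial_kernel) auto

lemma radial_kernel_nonneg:
  assumes "0 < \<alpha>" "0 \<le> s" "s \<le> 1" "0 \<le> r" "r < 1"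
  shows "0 \<le> radial_kernel \<alpha> r s"
  using assms mult_less_one[of s r] log_power_one_minus_square_pos[of \<alpha> "s*r"]
  by (simp add: radial_kernel_def)

definition radial_norm :: "real \<Rightarrow> real \<Rightarrow> real" where
  "radial_norm \<alpha> r = log_power \<alpha> (1 - r\<^sup>2) * integral {0..1} (radial_kernel \<alpha> r)"

section \<open>Upper and lower bounds for I(r)\<close>

text \<open>The model integral for both bounds, with \<open>b = \<alpha>/2\<close> from above and
  \<open>b = \<alpha>\<close> from below. The antiderivative divides by r, so r must be
  positive.\<close>

lemma has_integral_powr_inverse:
  fixes b r :: real
  assumes "0 < b" "0 < r" "r < 1"
  shows "((\<lambda>s. (1 - r) powr b * (1 - s * r) powr (-b - 1)) has_integral
           (1 - (1 - r) powr b) / (b * r)) {0..1}"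
proof -
  have "((\<lambda>s. (1 - r) powr b * (1 - s * r) powr (-b - 1)) has_integral
      ((1 - r) powr b * (1 - 1 * r) powr (-b) / (b * r)
        - (1 - r) powr b * (1 - 0 * r) powr (-b) / (b * r))) {0..1}"
  proof (rule fundamental_theorem_of_calculus)
    fix x :: real assume x: "x \<in> {0..1}"
    then have "1 - x * r > 0" using mult_less_one[of x r] assms by auto
    then show "((\<lambda>s. (1 - r) powr b * (1 - s * r) powr (-b) / (b * r)) has_vector_derivative
        (1 - r) powr b * (1 - x * r) powr (-b - 1)) (at x within {0..1})"
      unfolding has_real_derivative_iff_has_vector_derivative[symmetric]
      using assms by (auto intro!: derivative_eq_intros simp: field_simps powr_diff)
  qed auto
  also have "(1 - r) powr b * (1 - 1 * r) powr (-b) = 1"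
    using assms by (simp add: powr_minus)
  finally show ?thesis by (simp add: diff_divide_distrib)
qed

text \<open>Factoring \<open>1 - x^2 = (1 - x) (1 + x)\<close> leaves the ratio
  \<open>(1 + r) / (1 + s r)\<close>, which is at most 2.\<close>

lemma one_minus_square_ratio_le:
  fixes s r :: real
  assumes "0 \<le> s" "s \<le> 1" "0 \<le> r" "r < 1"
  shows "(1 - r\<^sup>2) / (1 - (s*r)\<^sup>2) \<le> 2 * ((1 - r) / (1 - s*r))"
proof -
  note m = mult_less_one[OF assms]
  have "(1 - r\<^sup>2) / (1 - (s*r)\<^sup>2) = ((1 - r) / (1 - s*r)) * ((1 + r) / (1 + s*r))"
    by (simp add: power2_eq_square algebra_simps)
  moreover have "(1 + r) / (1 + s*r) \<le> 2"
    using frac_le[of 2 "1 + r" 1 "1 + s*r"] m assms by simp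
  then have "((1 - r) / (1 - s*r)) * ((1 + r) / (1 + s*r)) \<le> ((1 - r) / (1 - s*r)) * 2"
    using m assms by (intro mult_left_mono) auto
  ultimately show ?thesis by (simp only: mult.commute)
qed

lemma radial_norm_le:
  assumes "0 < \<alpha>" "\<alpha> < 1" "0 \<le> r" "r < 1"
  shows "radial_norm \<alpha> r \<le> 12 / \<alpha>"
proof -
  define b where "b = \<alpha>/2"
  have b: "0 < b" "b < 1" using assms by (auto simp: b_def)
  \<comment> \<open>The constant is \<open>6 = 3 * 2\<close>: 3 from
    \<open>log_power_le_powr_half\<close>, and 2 bounds \<open>2 powr b\<close>, the cost of passing
    from squares to linear terms.\<close>
  define g where "g = (\<lambda>s. 6 * ((1 - r) powr b * (1 - s * r) powr (-b - 1)))"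
  have le: "log_power \<alpha> (1 - r\<^sup>2) * radial_kernel \<alpha> r s \<le> g s" if s: "s \<in> {0..1}" for s
  proof -
    have s': "0 \<le> s" "s \<le> 1" using s by auto
    note m = mult_less_one[OF s' assms(3,4)]
    note p = one_minus_square_bounds[OF m(1,3)] one_minus_square_bounds[OF assms(3,4)]
    let ?v = "1 - (s*r)\<^sup>2"
    have uv: "1 - r\<^sup>2 \<le> ?v" using m by (simp add: power_mono)
    have lv: "0 < log_power \<alpha> ?v" using m assms by (intro log_power_one_minus_square_pos) auto
    have "log_power \<alpha> (1 - r\<^sup>2) * radial_kernel \<alpha> r s
        = log_power \<alpha> (1 - r\<^sup>2) / log_power \<alpha> ?v / (1 - s*r)"
      by (simp add: radial_kernel_def)
    also have "\<dots> \<le> 3 * ((1 - r\<^sup>2) / ?v) powr b / (1 - s*r)"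
    proof (rule divide_right_mono)
      show "log_power \<alpha> (1 - r\<^sup>2) / log_power \<alpha> ?v \<le> 3 * ((1 - r\<^sup>2) / ?v) powr b"
        using log_power_le_powr_half[of \<alpha> "1 - r\<^sup>2" ?v] uv p assms lv
        by (simp add: b_def pos_divide_le_eq)
    qed (use m in auto)
    also have "\<dots> \<le> 3 * (2 * ((1 - r) / (1 - s*r))) powr b / (1 - s*r)"
      using one_minus_square_ratio_le[OF s' assms(3,4)] p m b
      by (intro divide_right_mono mult_left_mono powr_mono2) auto
    also have "(2 * ((1 - r) / (1 - s*r))) powr b
        = 2 powr b * ((1 - r) powr b / (1 - s*r) powr b)"
      using m assms by (simp only: powr_mult powr_divide)
    also have "3 * (2 powr b * ((1 - r) powr b / (1 - s*r) powr b)) / (1 - s*r)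
        = 3 * 2 powr b * ((1 - r) powr b * (1 - s * r) powr (-b - 1))"
      using m by (simp add: powr_diff powr_minus divide_inverse)
    also have "\<dots> \<le> g s"
      unfolding g_def using powr_mono[of b 1 "2::real"] b
      by (intro mult_right_mono) auto
    finally show ?thesis .
  qed
  have "\<exists>I. (g has_integral I) {0..1} \<and> I \<le> 6 / b"
  proof (cases "r = 0")
    case True
    then have "(g has_integral 6) {0..1}"
      using has_integral_const_real[of "6::real" 0 1] by (simp add: g_def)
    then show ?thesis using b by (auto simp: field_simps)
  next
    case False
    then have r: "0 < r" using assms by simp
    have "(g has_integral 6 * ((1 - (1 - r) powr b) / (b * r))) {0..1}"
      unfolding g_def using has_integral_powr_inverse[OF b(1) r assms(4)]
      by (rule has_integral_mult_right)
    \<comment> \<open>As \<open>b < 1\<close> and \<open>1 - r \<le> 1\<close>, the numerator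
      \<open>1 - (1 - r) powr b\<close> is at most r. This cancels the r in the denominator and
      makes the bound uniform down to r = 0.\<close>
    moreover have "(1 - r) powr 1 \<le> (1 - r) powr b"
      using b r assms by (intro powr_mono') auto
    then have "1 - (1 - r) powr b \<le> r" using assms by simp
    then have "(1 - (1 - r) powr b) / (b * r) \<le> r / (b * r)"
      using b r by (intro divide_right_mono) auto
    then have "(1 - (1 - r) powr b) / (b * r) \<le> 1 / b"
      using r by simp
    then have "6 * ((1 - (1 - r) powr b) / (b * r)) \<le> 6 / b"
      by linarith
    ultimately show ?thesis by blast
  qed
  then obtain I where I: "(g has_integral I) {0..1}" "I \<le> 6 / b" by blast
  have "radial_norm \<alpha> r = integral {0..1} (\<lambda>s. log_power \<alpha> (1 - r\<^sup>2) * radial_kernel \<alpha> r s)"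
    by (simp add: radial_norm_def)
  also have "\<dots> \<le> integral {0..1} g"
    using le I(1) radial_kernel_integrable[OF assms(1,3,4)]
    by (intro integral_le integrable_on_mult_right) (auto intro: has_integral_integrable)
  also have "\<dots> \<le> 12 / \<alpha>" using I by (auto simp: integral_unique b_def)
  finally show ?thesis .
qed

lemma radial_norm_ge:
  assumes "0 < \<alpha>" "0 < r" "r < 1"
  shows "(1 - (1 - r) powr \<alpha>) / \<alpha> \<le> radial_norm \<alpha> r"
proof -
  define g where "g = (\<lambda>s. (1 - r) powr \<alpha> * (1 - s * r) powr (-\<alpha> - 1))"
  have I: "(g has_integral (1 - (1 - r) powr \<alpha>) / (\<alpha> * r)) {0..1}"
    unfolding g_def by (rule has_integral_powr_inverse) (use assms in auto)
  have le: "g s \<le> log_power \<alpha> (1 - r\<^sup>2) * radial_kernel \<alpha> r s" if s: "s \<in> {0..1}" for s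
  proof -
    have s': "0 \<le> s" "s \<le> 1" "0 \<le> r" using s assms by auto
    note m = mult_less_one[OF s' assms(3)]
    note p = one_minus_square_bounds[OF m(1,3)] one_minus_square_bounds[OF s'(3) assms(3)]
    let ?v = "1 - (s*r)\<^sup>2" and ?u = "1 - r\<^sup>2"
    let ?l = "\<lambda>u. ln (2 * exp (1/\<alpha>) / u)"
    have uv: "?u \<le> ?v" using m by (simp add: power_mono)
    have "0 < 1/\<alpha>" using assms by simp
    then have lv: "0 < ?l ?v" using inverse_le_ln_two_exp_div[of ?v \<alpha>] p by linarith
    have luv: "?l ?v \<le> ?l ?u" using uv p by (simp add: ln_two_exp_div)
    have "(1 - r) / (1 - s*r) \<le> ((1 - r) / (1 - s*r)) * ((1 + r) / (1 + s*r))"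
      using m assms by (subst mult_le_cancel_left1) (auto simp: divide_simps)
    also have "\<dots> = ?u / ?v"
      by (simp add: power2_eq_square algebra_simps)
    finally have q: "(1 - r) / (1 - s*r) \<le> ?u / ?v" .
    have "g s = ((1 - r) / (1 - s*r)) powr \<alpha> / (1 - s*r)"
      using m assms by (simp add: g_def powr_divide powr_diff powr_minus field_simps)
    also have "\<dots> \<le> (?u / ?v) powr \<alpha> / (1 - s*r)"
      using q m assms by (intro divide_right_mono powr_mono2) auto
    also have "\<dots> \<le> (?u / ?v) powr \<alpha> * (?l ?u / ?l ?v) / (1 - s*r)"
      using luv lv m by (intro divide_right_mono mult_le_cancel_left1[THEN iffD2]) auto
    also have "\<dots> = log_power \<alpha> ?u * radial_kernel \<alpha> r s"
      using p by (simp add: radial_kernel_def log_power_def powr_divide)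
    finally show ?thesis .
  qed
  have "(1 - r) powr \<alpha> \<le> 1" using assms by (intro powr_le1) auto
  then have "(1 - (1 - r) powr \<alpha>) / \<alpha> \<le> (1 - (1 - r) powr \<alpha>) / (\<alpha> * r)"
    using assms by (intro divide_left_mono) auto
  also have "\<dots> = integral {0..1} g" using I by (simp add: integral_unique)
  also have "\<dots> \<le> integral {0..1} (\<lambda>s. log_power \<alpha> (1 - r\<^sup>2) * radial_kernel \<alpha> r s)"
    using le I(1) radial_kernel_integrable[of \<alpha> r] assms
    by (intro integral_le integrable_on_mult_right) (auto intro: has_integral_integrable)
  also have "\<dots> = radial_norm \<alpha> r" by (simp add: radial_norm_def)
  finally show ?thesis .
qed

text \<open>Let r tend to 1 in \<open>radial_norm_ge\<close>; the supremum bounds every term, hence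
  also the limit.\<close>

lemma one_div_le_SUP_radial_norm:
  assumes "0 < \<alpha>"
  shows "ennreal (1/\<alpha>) \<le> (SUP r\<in>{0..<1}. ennreal (radial_norm \<alpha> r))"
proof (rule tendsto_upperbound)
  \<comment> \<open>The base \<open>1 - r\<close> tends to 0, so convergence of the power rests on
    \<open>\<alpha> > 0\<close> and on the base being nonnegative near the limit.\<close>
  have "((\<lambda>r. (1 - (1 - r) powr \<alpha>) / \<alpha>) \<longlongrightarrow> (1 - (1 - 1) powr \<alpha>) / \<alpha>) (at_left 1)"
    using assms by (intro tendsto_intros tendsto_powr') (auto intro!: eventually_at_leftI[of 0])
  then show "((\<lambda>r. ennreal ((1 - (1 - r) powr \<alpha>) / \<alpha>)) \<longlongrightarrow> ennreal (1/\<alpha>)) (at_left 1)"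
    by (intro tendsto_ennrealI) simp
  show "\<forall>\<^sub>F r in at_left 1. ennreal ((1 - (1 - r) powr \<alpha>) / \<alpha>)
      \<le> (SUP r\<in>{0..<1}. ennreal (radial_norm \<alpha> r))"
  proof (rule eventually_at_leftI[of 0])
    fix r :: real assume "r \<in> {0<..<1}"
    then show "ennreal ((1 - (1 - r) powr \<alpha>) / \<alpha>) \<le> (SUP r\<in>{0..<1}. ennreal (radial_norm \<alpha> r))"
      using radial_norm_ge[OF assms, of r] by (intro SUP_upper2[of r] ennreal_leI) auto
  qed auto
qed auto

section \<open>Change of variables to the semigroup form\<close>

text \<open>The last factor is \<open>|ds/dt|\<close> for \<open>s = e / d\<close>. Since
  \<open>1 - s r = (1 - r) / d\<close> and \<open>1 - (s r)^2 = (1 - r) c / d^2\<close>, all powers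
  of \<open>1 - r\<close> outside the logarithms cancel, and those of d combine to
  \<open>d powr (2*\<alpha> - 1)\<close>.\<close>

lemma cesaro_kernel_eq_radial_kernel:
  fixes \<alpha> r t :: real
  assumes "0 < \<alpha>" "0 \<le> r" "r < 1" "0 \<le> t"
  defines "e \<equiv> exp (-t)" and "d \<equiv> 1 - (1 - exp (-t)) * r"
  shows "cesaro_kernel \<alpha> r t
    = log_power \<alpha> (1 - r\<^sup>2) * radial_kernel \<alpha> r (e / d) * (e * (1 - r) / d\<^sup>2)"
proof -
  define c where "c = 1 - (1 - 2 * e) * r"
  have e: "0 < e" "e \<le> 1" using assms by (auto simp: e_def)
  have d: "d = 1 - r + e * r" by (simp add: d_def e_def algebra_simps)
  have c: "c = 1 - r + 2 * e * r" by (simp add: c_def algebra_simps)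
  have d0: "0 < d" "0 < c" unfolding d c using e assms(2,3) by (auto intro: add_pos_nonneg)
  have 1: "1 - e / d * r = (1 - r) / d" using d0 by (simp add: field_simps d)
  have 2: "1 - (e / d * r)\<^sup>2 = (1 - r) * c / d\<^sup>2"
    using d0 by (simp add: field_simps power2_eq_square) (simp add: c d algebra_simps)
  have 3: "1 - r\<^sup>2 = (1 - r) * (1 + r)" by (simp add: power2_eq_square algebra_simps)
  have 4: "((1 - r) * c / d\<^sup>2) powr \<alpha> = (1 - r) powr \<alpha> * c powr \<alpha> / d powr (2 * \<alpha>)"
    using d0 assms
    by (simp add: powr_mult powr_divide powr_powr flip: powr_numeral)
  have 5: "(1 - r\<^sup>2) powr \<alpha> = (1 - r) powr \<alpha> * (1 + r) powr \<alpha>"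
    unfolding 3 using assms by (simp add: powr_mult)
  define L where "L = ln (2 * exp (1/\<alpha>) / ((1 - r) * c / d\<^sup>2))"
  define K where "K = ln (2 * exp (1/\<alpha>) / (1 - r\<^sup>2))"
  have "cesaro_kernel \<alpha> r t = (1 + r) powr \<alpha> * e * d powr (2*\<alpha> - 1) * K / (c powr \<alpha> * L)"
    unfolding cesaro_kernel_def d_def[symmetric] K_def L_def 2[symmetric]
    unfolding e_def[symmetric] c_def[symmetric] by simp
  moreover have "log_power \<alpha> (1 - r\<^sup>2) * radial_kernel \<alpha> r (e / d) * (e * (1 - r) / d\<^sup>2)
    = ((1 - r) powr \<alpha> * (1 + r) powr \<alpha> * K)
      * (1 / ((1 - r) powr \<alpha> * c powr \<alpha> / d powr (2 * \<alpha>) * L * ((1 - r) / d)))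
      * (e * (1 - r) / d\<^sup>2)"
    unfolding radial_kernel_def log_power_def 1 2 4 5 K_def L_def by simp
  moreover have "((1 - r) powr \<alpha> * (1 + r) powr \<alpha> * K)
      * (1 / ((1 - r) powr \<alpha> * c powr \<alpha> / d powr (2 * \<alpha>) * L * ((1 - r) / d)))
      * (e * (1 - r) / d\<^sup>2)
    = (1 + r) powr \<alpha> * e * (d powr (2*\<alpha>) / d) * K / (c powr \<alpha> * L)"
  proof -
    have "(1 - r) powr \<alpha> \<noteq> 0" "c powr \<alpha> \<noteq> 0" "1 - r \<noteq> 0" "d \<noteq> 0"
      using d0 assms(3) by auto
    \<comment> \<open>If \<open>L = 0\<close>, both sides vanish because division by zero gives 0,
      so positivity of the logarithm need not be shown here.\<close>
    then show ?thesis by (cases "L = 0") (simp_all add: divide_simps power2_eq_square)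
  qed
  moreover have "d powr (2*\<alpha> - 1) = d powr (2*\<alpha>) / d" using d0 by (simp add: powr_diff)
  ultimately show ?thesis by (simp only:)
qed

text \<open>The substitution \<open>s = e\<^bsup>-t\<^esup> / (1 - (1 - e\<^bsup>-t\<^esup>) r)\<close>
  turns the semigroup form of the integral into the radial one.\<close>

lemma nn_integral_cesaro_kernel:
  assumes "0 < \<alpha>" "0 \<le> r" "r < 1"
  shows "(\<integral>\<^sup>+ t\<in>{0..}. ennreal (cesaro_kernel \<alpha> r t) \<partial>lborel) = ennreal (radial_norm \<alpha> r)"
proof -
  define W where "W = log_power \<alpha> (1 - r\<^sup>2)"
  \<comment> \<open>The value s = 1 is attained at t = 0, where a two-sided derivative of G is
    required. Hence the interval extends to some \<open>b > 1\<close>, with \<open>b * r < 1\<close>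
    to keep the kernel continuous on it.\<close>
  define b where "b = 2 / (1 + r)"
  define G where "G = (\<lambda>x. integral {0..x} (radial_kernel \<alpha> r))"
  define d where "d = (\<lambda>t::real. 1 - (1 - exp (-t)) * r)"
  define s where "s = (\<lambda>t. exp (-t) / d t)"
  have b: "1 < b" "b * r < 1" using assms by (auto simp: b_def field_simps)
  have W: "0 < W" unfolding W_def by (rule log_power_one_minus_square_pos) (use assms in auto)
  have d: "0 < d t" if "0 \<le> t" for t
  proof -
    have "d t = 1 - r + exp (-t) * r" by (simp add: d_def algebra_simps)
    then show ?thesis using assms by (auto intro: add_pos_nonneg)
  qed
  have s: "0 < s t" "s t \<le> 1" if "0 \<le> t" for t
  proof -
    have "exp (-t) * (1 - r) \<le> 1 * (1 - r)" using that assms by (intro mult_right_mono) auto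
    then show "0 < s t" "s t \<le> 1" using d[OF that] by (auto simp: s_def d_def field_simps)
  qed
  have cont: "continuous_on {0..b} (radial_kernel \<alpha> r)"
  proof (rule continuous_on_radial_kernel[OF assms(1)])
    fix x assume "x \<in> {0..b}"
    then show "0 \<le> x * r \<and> x * r < 1"
      using b assms mult_right_mono[of x b r] by auto
  qed
  have G: "(G has_real_derivative radial_kernel \<alpha> r x) (at x)" if "0 < x" "x \<le> 1" for x
  proof -
    have "(G has_real_derivative radial_kernel \<alpha> r x) (at x within {0..b})"
      unfolding G_def using cont that b by (intro integral_has_real_derivative) auto
    moreover have "at x within {0..b} = at x"
      using that b by (intro at_within_interior) auto
    ultimately show ?thesis by simp
  qed
  have s': "(s has_real_derivative - (exp (-t) * (1 - r) / (d t)\<^sup>2)) (at t)" if "0 \<le> t" for t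
  proof -
    have "d t \<noteq> 0" using d[OF that] by simp
    moreover have "(d has_real_derivative - exp (-t) * r) (at t)"
      unfolding d_def by (auto intro!: derivative_eq_intros)
    ultimately have "(s has_real_derivative
        ((- exp (-t)) * d t - exp (-t) * (- exp (-t) * r)) / (d t * d t)) (at t)"
      unfolding s_def by (auto intro!: derivative_eq_intros)
    moreover have "(- exp (-t)) * d t - exp (-t) * (- exp (-t) * r) = - (exp (-t) * (1 - r))"
      by (simp add: d_def algebra_simps)
    ultimately show ?thesis by (simp only: power2_eq_square minus_divide_left)
  qed
  have ker: "cesaro_kernel \<alpha> r t = W * radial_kernel \<alpha> r (s t) * (exp (-t) * (1 - r) / (d t)\<^sup>2)"
    if "0 \<le> t" for t
    unfolding W_def s_def d_def using assms that by (intro cesaro_kernel_eq_radial_kernel) auto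
  have "(\<integral>\<^sup>+ t. ennreal (cesaro_kernel \<alpha> r t) * indicator {0..} t \<partial>lborel)
      = ennreal (0 - (- W * G (s 0)))"
  proof (rule nn_integral_FTC_atLeast)
    show "cesaro_kernel \<alpha> r \<in> borel_measurable borel"
      unfolding cesaro_kernel_def by measurable
    \<comment> \<open>The minus sign is there because s decreases from 1 to 0; the antiderivative
      runs from \<open>- W * G 1\<close> at t = 0 up to the limit 0.\<close>
    show "((\<lambda>t. - W * G (s t)) has_real_derivative cesaro_kernel \<alpha> r t) (at t)"
      if "0 \<le> t" for t
      using DERIV_cmult[OF DERIV_chain2[OF G[OF s[OF that]] s'[OF that]], of "- W"]
      by (simp add: ker[OF that] mult_ac)
    show "0 \<le> cesaro_kernel \<alpha> r t" if "0 \<le> t" for t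
      unfolding ker[OF that] using W assms s[OF that]
      by (intro mult_nonneg_nonneg radial_kernel_nonneg) auto
    have "continuous_on {0..b} G"
      unfolding G_def by (intro indefinite_integral_continuous_1 integrable_continuous_real cont)
    moreover have "(s \<longlongrightarrow> 0) at_top"
    proof -
      have e: "((\<lambda>t::real. exp (-t)) \<longlongrightarrow> 0) at_top"
        using exp_at_bot filterlim_uminus_at_bot_at_top by (rule filterlim_compose)
      have "(s \<longlongrightarrow> 0 / (1 - (1 - 0) * r)) at_top"
        unfolding s_def d_def using assms e by (intro tendsto_intros) auto
      then show ?thesis by simp
    qed
    moreover have "\<forall>\<^sub>F t in at_top. s t \<in> {0..b}"
      using eventually_ge_at_top[of 0] by eventually_elim (use s b in force)
    ultimately have "((\<lambda>t. G (s t)) \<longlongrightarrow> G 0) at_top"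
      using b by (intro continuous_on_tendsto_compose[of "{0..b}" G]) auto
    then have "((\<lambda>t. - W * G (s t)) \<longlongrightarrow> - W * G 0) at_top" by (intro tendsto_intros)
    then show "((\<lambda>t. - W * G (s t)) \<longlongrightarrow> 0) at_top" by (simp add: G_def)
  qed
  also have "0 - (- W * G (s 0)) = radial_norm \<alpha> r"
    by (simp add: radial_norm_def W_def G_def s_def d_def)
  finally show ?thesis .
qed

section \<open>The Cesaro operator on analytic functions\<close>

text \<open>Differentiation under the integral sign: the integrand is \<open>g (t z)\<close> with
  \<open>g z = f z / (1 - z)\<close> analytic, and the segment from 0 to z stays in the
  disc.\<close>

lemma cesaro_holomorphic_on:
  assumes "f holomorphic_on ball 0 1"
  shows "cesaro f holomorphic_on ball 0 1"
proof -
  define g where "g = (\<lambda>z. f z / (1 - z))"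
  have g: "g holomorphic_on ball 0 1"
    unfolding g_def using assms by (intro holomorphic_intros) auto
  have g': "deriv g holomorphic_on ball 0 1" using g by (intro holomorphic_deriv) auto
  have mem: "of_real t * z \<in> ball (0::complex) 1" if "z \<in> ball 0 1" "t \<in> {0..1}" for t z
    using that mult_less_one[of t "cmod z"] by (auto simp: norm_mult)
  have "(\<lambda>z. integral (cbox 0 1) (\<lambda>t. g (of_real t * z))) holomorphic_on ball 0 1"
  proof (rule leibniz_rule_holomorphic)
    fix z :: complex and t :: real assume z: "z \<in> ball 0 1" and t: "t \<in> cbox 0 1"
    have "(g has_field_derivative deriv g (of_real t * z)) (at (of_real t * z))"
      using g mem[of z t] z t by (intro holomorphic_derivI[of g "ball 0 1"]) auto
    moreover have "((\<lambda>z. of_real t * z) has_field_derivative of_real t) (at z within ball 0 1)"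
      by (auto intro!: derivative_eq_intros)
    ultimately show "((\<lambda>z. g (of_real t * z)) has_field_derivative deriv g (of_real t * z) * of_real t)
        (at z within ball 0 1)"
      by (rule DERIV_chain2)
  next
    fix z :: complex assume z: "z \<in> ball 0 1"
    show "(\<lambda>t. g (of_real t * z)) integrable_on cbox 0 1"
      using mem[OF z]
      by (intro integrable_continuous continuous_on_compose2[OF holomorphic_on_imp_continuous_on[OF g]]
          continuous_intros) auto
  next
    show "continuous_on (ball 0 1 \<times> cbox 0 1)
        (\<lambda>(z, t). deriv g (complex_of_real t * z) * complex_of_real t)"
      unfolding split_beta using mem
      by (intro continuous_intros continuous_on_compose2[OF holomorphic_on_imp_continuous_on[OF g']])
         auto
  qed auto
  then show ?thesis by (simp add: cesaro_def[abs_def] g_def)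
qed

lemma cesaro_pointwise_bound:
  assumes "0 < \<alpha>" "f holomorphic_on ball 0 1"
    and M: "\<And>z. z \<in> ball 0 1 \<Longrightarrow> klog_weight \<alpha> z * cmod (f z) \<le> M"
    and z: "z \<in> ball 0 1"
  shows "klog_weight \<alpha> z * cmod (cesaro f z) \<le> M * radial_norm \<alpha> (cmod z)"
proof -
  define r where "r = cmod z"
  have r: "0 \<le> r" "r < 1" using z by (auto simp: r_def)
  have mem: "of_real t * z \<in> ball (0::complex) 1" if "t \<in> {0..1}" for t
    using that r mult_less_one[of t r] by (auto simp: norm_mult r_def)
  have "cmod (cesaro f z) \<le> integral {0..1} (\<lambda>t. M * radial_kernel \<alpha> r t)"
    unfolding cesaro_def
  proof (rule integral_norm_bound_integral)
    have "(\<lambda>z. f z / (1 - z)) holomorphic_on ball 0 1"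
      using assms(2) by (intro holomorphic_intros) auto
    then have "continuous_on {0..1} (\<lambda>t. f (of_real t * z) / (1 - of_real t * z))"
      by (rule continuous_on_compose2[OF holomorphic_on_imp_continuous_on])
        (use mem in \<open>auto intro!: continuous_intros\<close>)
    then show "(\<lambda>t. f (of_real t * z) / (1 - of_real t * z)) integrable_on {0..1}"
      by (rule integrable_continuous_real)
    show "(\<lambda>t. M * radial_kernel \<alpha> r t) integrable_on {0..1}"
      using radial_kernel_integrable[OF assms(1) r] by (intro integrable_on_mult_right)
  next
    fix t :: real assume t: "t \<in> {0..1}"
    have n: "cmod (of_real t * z) = t * r" using t by (simp add: norm_mult r_def)
    have m: "0 \<le> t * r" "t * r < 1" using t r mult_less_one[of t r] by auto
    note p = log_power_one_minus_square_pos[OF assms(1) m]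
    have a: "cmod (f (of_real t * z)) \<le> M / log_power \<alpha> (1 - (t*r)\<^sup>2)"
      using M[OF mem[OF t]] p unfolding klog_weight_eq_log_power n
      by (simp add: pos_le_divide_eq mult.commute)
    have b: "1 - t * r \<le> cmod (1 - of_real t * z)"
      using norm_triangle_ineq2[of 1 "of_real t * z"] n by simp
    have "cmod (f (of_real t * z)) / cmod (1 - of_real t * z)
        \<le> (M / log_power \<alpha> (1 - (t*r)\<^sup>2)) / (1 - t * r)"
      by (rule frac_le) (use a b m norm_ge_zero[of "f (of_real t * z)"] in linarith)+
    then show "cmod (f (of_real t * z) / (1 - of_real t * z)) \<le> M * radial_kernel \<alpha> r t"
      by (simp add: norm_divide radial_kernel_def)
  qed
  then have "log_power \<alpha> (1 - r\<^sup>2) * cmod (cesaro f z)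
      \<le> log_power \<alpha> (1 - r\<^sup>2) * (M * integral {0..1} (radial_kernel \<alpha> r))"
    using log_power_one_minus_square_pos[OF assms(1) r] by (intro mult_left_mono) auto
  then show ?thesis
    by (simp add: radial_norm_def klog_weight_eq_log_power r_def mult_ac)
qed

text \<open>Passage from \<open>ennreal\<close> to real inequalities. For negative M,
  \<open>ennreal M\<close> collapses to 0 and the equivalence fails for f = 0.\<close>

lemma klog_norm_le_iff:
  assumes "0 \<le> M"
  shows "klog_norm \<alpha> f \<le> ennreal M \<longleftrightarrow> (\<forall>z\<in>ball 0 1. klog_weight \<alpha> z * cmod (f z) \<le> M)"
  using assms by (simp add: klog_norm_def SUP_le_iff)

section \<open>The extremal function\<close>

text \<open>The function of the overview on the principal branch. Splitting the logarithm makes the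
  real part of the denominator equal to
  \<open>ln (2 * exp (1/\<alpha>) / |1 - z^2|)\<close>.\<close>

definition extremal :: "real \<Rightarrow> complex \<Rightarrow> complex" where
  "extremal \<alpha> z = exp (- of_real \<alpha> * Ln (1 - z\<^sup>2)) / (of_real (ln 2 + 1/\<alpha>) - Ln (1 - z\<^sup>2))"

text \<open>On the disc \<open>Re (1 - z^2) > 0\<close>, so the principal logarithm is analytic
  there. As \<open>|1 - z^2| \<le> 2\<close>, the real part of the denominator is at least
  \<open>1/\<alpha>\<close>, which excludes zeros.\<close>

lemma extremal_denominator:
  assumes "0 < \<alpha>" "z \<in> ball 0 1"
  shows "1 - z\<^sup>2 \<notin> \<real>\<^sub>\<le>\<^sub>0" "1 - (cmod z)\<^sup>2 \<le> cmod (1 - z\<^sup>2)" "cmod (1 - z\<^sup>2) \<le> 2" "1 - z\<^sup>2 \<noteq> 0"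
    "ln (2 * exp (1/\<alpha>) / cmod (1 - z\<^sup>2)) \<le> cmod (of_real (ln 2 + 1/\<alpha>) - Ln (1 - z\<^sup>2))"
    "of_real (ln 2 + 1/\<alpha>) - Ln (1 - z\<^sup>2) \<noteq> 0"
proof -
  have r: "(cmod z)\<^sup>2 < 1" using assms by (simp add: power_less_one_iff)
  have "Re (z\<^sup>2) \<le> (cmod z)\<^sup>2" using complex_Re_le_cmod[of "z\<^sup>2"] by (simp add: norm_power)
  then have "0 < Re (1 - z\<^sup>2)" using r by simp
  then show 1: "1 - z\<^sup>2 \<notin> \<real>\<^sub>\<le>\<^sub>0" by (auto simp: complex_nonpos_Reals_iff)
  then show 0: "1 - z\<^sup>2 \<noteq> 0" by auto
  show "1 - (cmod z)\<^sup>2 \<le> cmod (1 - z\<^sup>2)"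
    using norm_triangle_ineq2[of 1 "z\<^sup>2"] by (simp add: norm_power)
  show 2: "cmod (1 - z\<^sup>2) \<le> 2"
    using norm_triangle_ineq4[of 1 "z\<^sup>2"] r by (simp add: norm_power)
  have "ln (2 * exp (1/\<alpha>) / cmod (1 - z\<^sup>2)) = Re (of_real (ln 2 + 1/\<alpha>) - Ln (1 - z\<^sup>2))"
    using 0 by (simp add: ln_two_exp_div)
  also have "\<dots> \<le> cmod (of_real (ln 2 + 1/\<alpha>) - Ln (1 - z\<^sup>2))" by (rule complex_Re_le_cmod)
  finally show 3: "ln (2 * exp (1/\<alpha>) / cmod (1 - z\<^sup>2))
      \<le> cmod (of_real (ln 2 + 1/\<alpha>) - Ln (1 - z\<^sup>2))" .
  have "0 < 1/\<alpha>" using assms by simp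
  then have "0 < cmod (of_real (ln 2 + 1/\<alpha>) - Ln (1 - z\<^sup>2))"
    using 3 inverse_le_ln_two_exp_div[of "cmod (1 - z\<^sup>2)" \<alpha>] 0 2 by (smt (verit) zero_less_norm_iff)
  then show "of_real (ln 2 + 1/\<alpha>) - Ln (1 - z\<^sup>2) \<noteq> 0" by auto
qed

lemma extremal_holomorphic_on:
  assumes "0 < \<alpha>"
  shows "extremal \<alpha> holomorphic_on ball 0 1"
  unfolding extremal_def using extremal_denominator[OF assms]
  by (intro holomorphic_intros) auto

text \<open>Monotonicity of \<open>log_power\<close> moves from \<open>1 - |z|^2\<close> up to
  \<open>|1 - z^2|\<close>, and the modulus of the denominator dominates its real part.\<close>

lemma extremal_bound:
  assumes "0 < \<alpha>" "z \<in> ball 0 1"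
  shows "klog_weight \<alpha> z * cmod (extremal \<alpha> z) \<le> 1"
proof -
  note e = extremal_denominator[OF assms]
  let ?v = "cmod (1 - z\<^sup>2)" and ?D = "of_real (ln 2 + 1/\<alpha>) - Ln (1 - z\<^sup>2)"
  have n: "cmod (extremal \<alpha> z) = 1 / (?v powr \<alpha> * cmod ?D)"
  proof -
    have "cmod (exp (- of_real \<alpha> * Ln (1 - z\<^sup>2))) = 1 / ?v powr \<alpha>"
      using e(4) by (simp add: powr_def exp_minus norm_inverse divide_inverse)
    then show ?thesis by (simp add: extremal_def norm_divide)
  qed
  have p: "0 < 1 - (cmod z)\<^sup>2" using assms by (simp add: power_less_one_iff)
  have "klog_weight \<alpha> z \<le> log_power \<alpha> ?v"
    unfolding klog_weight_eq_log_power using e assms p by (intro log_power_mono) auto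
  also have "\<dots> \<le> ?v powr \<alpha> * cmod ?D"
    unfolding log_power_def using e(5) by (intro mult_left_mono) auto
  finally show ?thesis
    using e(4,6) by (simp add: n pos_divide_le_eq)
qed

lemma extremal_of_real:
  assumes "0 \<le> x" "x < 1"
  shows "extremal \<alpha> (of_real x) = of_real (1 / log_power \<alpha> (1 - x\<^sup>2))"
proof -
  have p: "0 < 1 - x\<^sup>2" by (rule one_minus_square_bounds[OF assms])
  have "Ln (1 - (of_real x)\<^sup>2) = of_real (ln (1 - x\<^sup>2))"
    using Ln_of_real[OF p] by simp
  then have "extremal \<alpha> (of_real x)
      = of_real (exp (- \<alpha> * ln (1 - x\<^sup>2)) / (ln 2 + 1/\<alpha> - ln (1 - x\<^sup>2)))"
    by (simp add: extremal_def exp_of_real[symmetric])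
  also have "exp (- \<alpha> * ln (1 - x\<^sup>2)) / (ln 2 + 1/\<alpha> - ln (1 - x\<^sup>2)) = 1 / log_power \<alpha> (1 - x\<^sup>2)"
    unfolding log_power_def ln_two_exp_div[OF p] using p
    by (simp add: powr_def exp_minus field_simps)
  finally show ?thesis .
qed

text \<open>On the positive radius the integrand equals its majorant, which is real and nonnegative,
  so nothing is lost in taking the modulus of the integral.\<close>

lemma klog_weight_cesaro_extremal:
  assumes "0 < \<alpha>" "0 \<le> r" "r < 1"
  shows "klog_weight \<alpha> (of_real r) * cmod (cesaro (extremal \<alpha>) (of_real r)) = radial_norm \<alpha> r"
proof -
  have "cesaro (extremal \<alpha>) (of_real r) = integral {0..1} (\<lambda>t. of_real (radial_kernel \<alpha> r t))"
    unfolding cesaro_def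
  proof (rule integral_cong)
    fix t :: real assume t: "t \<in> {0..1}"
    then have m: "0 \<le> t * r" "t * r < 1" using mult_less_one[of t r] assms by auto
    show "extremal \<alpha> (of_real t * of_real r) / (1 - of_real t * of_real r)
        = of_real (radial_kernel \<alpha> r t)"
      using extremal_of_real[OF m, of \<alpha>] by (simp add: radial_kernel_def)
  qed
  also have "\<dots> = of_real (integral {0..1} (radial_kernel \<alpha> r))"
    by (intro integral_unique has_integral_of_real integrable_integral radial_kernel_integrable assms)
  finally have "cmod (cesaro (extremal \<alpha>) (of_real r)) = \<bar>integral {0..1} (radial_kernel \<alpha> r)\<bar>"
    by simp
  moreover have "0 \<le> integral {0..1} (radial_kernel \<alpha> r)"
    using assms by (intro integral_nonneg radial_kernel_integrable radial_kernel_nonneg) auto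
  ultimately show ?thesis
    by (simp add: klog_weight_eq_log_power radial_norm_def)
qed

section \<open>Operator norm and boundedness\<close>

text \<open>The upper bound is \<open>cesaro_pointwise_bound\<close> with \<open>M = 1\<close>; the
  lower bound tests the operator on \<open>extremal \<alpha>\<close> at the points z = r.\<close>

lemma cesaro_klog_opnorm_eq:
  assumes "0 < \<alpha>"
  shows "cesaro_klog_opnorm \<alpha> = (SUP r\<in>{0..<1}. ennreal (radial_norm \<alpha> r))"
proof (rule antisym)
  show "cesaro_klog_opnorm \<alpha> \<le> (SUP r\<in>{0..<1}. ennreal (radial_norm \<alpha> r))"
    unfolding cesaro_klog_opnorm_def
  proof (rule SUP_least)
    fix f assume "f \<in> {f. f holomorphic_on ball 0 1 \<and> klog_norm \<alpha> f \<le> 1}"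
    then have f: "f holomorphic_on ball 0 1"
      and "\<And>z. z \<in> ball 0 1 \<Longrightarrow> klog_weight \<alpha> z * cmod (f z) \<le> 1"
      using klog_norm_le_iff[of 1 \<alpha> f] by auto
    from cesaro_pointwise_bound[OF assms this]
    show "klog_norm \<alpha> (cesaro f) \<le> (SUP r\<in>{0..<1}. ennreal (radial_norm \<alpha> r))"
      unfolding klog_norm_def by (intro SUP_mono) (force intro: ennreal_leI)
  qed
next
  have "ennreal (radial_norm \<alpha> r) \<le> klog_norm \<alpha> (cesaro (extremal \<alpha>))" if "r \<in> {0..<1}" for r
    unfolding klog_norm_def using klog_weight_cesaro_extremal[OF assms, of r] that
    by (intro SUP_upper2[of "of_real r"]) auto
  moreover have "klog_norm \<alpha> (extremal \<alpha>) \<le> 1"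
    using klog_norm_le_iff[of 1 \<alpha> "extremal \<alpha>"] extremal_bound[OF assms] by simp
  ultimately show "(SUP r\<in>{0..<1}. ennreal (radial_norm \<alpha> r)) \<le> cesaro_klog_opnorm \<alpha>"
    unfolding cesaro_klog_opnorm_def using extremal_holomorphic_on[OF assms]
    by (intro SUP_least) (blast intro: SUP_upper2)
qed

lemma cesaro_in_klog_space:
  assumes "0 < \<alpha>" "\<alpha> < 1" "f \<in> klog_space \<alpha>"
  shows "cesaro f \<in> klog_space \<alpha>"
proof -
  have f: "f holomorphic_on ball 0 1" and n: "klog_norm \<alpha> f < \<infinity>"
    using assms by (auto simp: klog_space_def)
  then obtain M where M: "0 \<le> M" "klog_norm \<alpha> f = ennreal M"
    by (cases "klog_norm \<alpha> f") auto
  then have b: "klog_weight \<alpha> z * cmod (f z) \<le> M" if "z \<in> ball 0 1" for z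
    using klog_norm_le_iff[OF M(1), of \<alpha> f] that by simp
  have "klog_weight \<alpha> z * cmod (cesaro f z) \<le> M * (12/\<alpha>)" if z: "z \<in> ball 0 1" for z
    using cesaro_pointwise_bound[OF assms(1) f b z] M(1) z
      mult_left_mono[OF radial_norm_le[OF assms(1,2), of "cmod z"], of M] by simp
  then have "klog_norm \<alpha> (cesaro f) \<le> ennreal (M * (12/\<alpha>))"
    using M(1) assms by (subst klog_norm_le_iff) auto
  then show ?thesis
    using cesaro_holomorphic_on[OF f] by (auto simp: klog_space_def intro: le_less_trans)
qed

theorem theorem5p1:
  fixes \<alpha> :: real
  assumes "0 < \<alpha>" and "\<alpha> < 1"
  shows "(\<forall>f\<in>klog_space \<alpha>. cesaro f \<in> klog_space \<alpha>)
    \<and> cesaro_klog_opnorm \<alpha> < \<infinity>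
    \<and> cesaro_klog_opnorm \<alpha> =
        (SUP r\<in>{0..<1}. \<integral>\<^sup>+ t\<in>{0..}. ennreal (cesaro_kernel \<alpha> r t) \<partial>lborel)
    \<and> cesaro_klog_opnorm \<alpha> \<ge> ennreal (1 / \<alpha>)"
proof (intro conjI)
  show "\<forall>f\<in>klog_space \<alpha>. cesaro f \<in> klog_space \<alpha>"
    using cesaro_in_klog_space[OF assms] by blast
  have "cesaro_klog_opnorm \<alpha> \<le> ennreal (12/\<alpha>)"
    unfolding cesaro_klog_opnorm_eq[OF assms(1)]
    using radial_norm_le[OF assms] by (intro SUP_least ennreal_leI) auto
  then show "cesaro_klog_opnorm \<alpha> < \<infinity>" by (auto intro: le_less_trans)
  show "cesaro_klog_opnorm \<alpha> =
      (SUP r\<in>{0..<1}. \<integral>\<^sup>+ t\<in>{0..}. ennreal (cesaro_kernel \<alpha> r t) \<partial>lborel)"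
    unfolding cesaro_klog_opnorm_eq[OF assms(1)]
    using nn_integral_cesaro_kernel[OF assms(1)] by (intro SUP_cong) auto
  show "cesaro_klog_opnorm \<alpha> \<ge> ennreal (1 / \<alpha>)"
    unfolding cesaro_klog_opnorm_eq[OF assms(1)] by (rule one_div_le_SUP_radial_norm[OF assms(1)])
qed

end
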